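(* Let $G$ be a group, regarded as a semigroup under its multiplication. Then $\mathrm{Orientable}(G) = [G,G]$ as subsets of $G$, where $\mathrm{Orientable}(G)$ is the set of orientable elements of $G$ and $[G,G]$ is the commutator subgroup of $G$.
   Context: Let $S$ be a semigroup (a set with an associative binary operation) and let $t \notin S$ be a variable symbol. A simple equation over $S$ in the variable $t$ is an expression $a = b\,t\,c$, where $a$ is an element of $S$ and each of $b, c$ is either an element of $S$ or empty (i.e. absent from the expression), with at least one of $b, c$ non-empty. An element $w \in S$ satisfies the equation if $a = bwc$ holds in $S$ (with empty coefficients simply omitted from the product). The simple equation $a = btc$ is called an orientable equation if there are elements $x_1,\dots,x_n$ of $S$ (not necessarily distinct) and factorizations in $S$ $$a=\prod_{i=1}^{n_1}a_i,\qquad b=\prod_{j=1}^{n_2}b_j,\qquad c=\prod_{k=1}^{n_3}c_k,$$ with all factors elements of $S$, such that $n_1+n_2+n_3=2n$, $n_1=n_2+n_3$, and each $x_\nu$ ($1\le \nu\le n$) occurs once among $a_1,\dots,a_{n_1}$ and once among $b_1,\dots,b_{n_2},c_1,\dots,c_{n_3}$. In other words, the lists $(a_1,\dots,a_{n_1})$ and $(b_1,\dots,b_{n_2},c_1,\dots,c_{n_3})$ are both rearrangements of the list $(x_1,\dots,x_n)$, i.e. they agree as multisets. A product with zero factors is understood to be empty, so $n_2=0$ (resp. $n_3=0$) exactly when $b$ (resp. $c$) is empty, and $n_1\ge 1$. An element of $S$ is orientable if it satisfies some orientable equation over $S$, and $\mathrm{Orientable}(S)$ denotes the set of all orientable elements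 of $S$. The commutator subgroup $[G,G]$ of a group $G$ is the smallest subgroup of $G$ containing all elements $xyx^{-1}y^{-1}$ with $x,y\in G$. *)

theory Defs
  imports "HOL-Algebra.Generated_Groups" "HOL-Library.Multiset"
begin

text \<open>
  Semigroups on an explicit carrier set. A possibly empty coefficient of an equation
  is an option value, \<^term>\<open>None\<close> meaning that the coefficient is absent.
\<close>

locale semigroup_on =
  fixes S :: "'a set"
    and f :: "'a \<Rightarrow> 'a \<Rightarrow> 'a"  (infixl \<open>\<odot>\<close> 70)
  assumes closed: "\<lbrakk>x \<in> S; y \<in> S\<rbrakk> \<Longrightarrow> x \<odot> y \<in> S"
    and assoc: "\<lbrakk>x \<in> S; y \<in> S; z \<in> S\<rbrakk> \<Longrightarrow> (x \<odot> y) \<odot> z = x \<odot> (y \<odot> z)"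
begin

text \<open>
  As a semigroup need not have an identity, a product of zero factors is the empty
  expression \<^term>\<open>None\<close>, never an element (not even the identity, if there is one).
\<close>

primrec list_product :: "'a list \<Rightarrow> 'a option" where
  "list_product [] = None"
| "list_product (x # xs) =
     Some (case list_product xs of None \<Rightarrow> x | Some y \<Rightarrow> x \<odot> y)"

text \<open>The triple \<open>a b c\<close> stands for the expression \<open>a = b t c\<close>.\<close>

definition simple_equation :: "'a \<Rightarrow> 'a option \<Rightarrow> 'a option \<Rightarrow> bool" where
  "simple_equation a b c \<longleftrightarrow>
     a \<in> S \<and> set_option b \<subseteq> S \<and> set_option c \<subseteq> S \<and> (b \<noteq> None \<or> c \<noteq> None)"

definition satisfies :: "'a \<Rightarrow> 'a \<Rightarrow> 'a option \<Rightarrow> 'a option \<Rightarrow> bool" where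
  "satisfies w a b c \<longleftrightarrow>
     a = (case (b, c) of
            (None, None) \<Rightarrow> w
          | (Some b', None) \<Rightarrow> b' \<odot> w
          | (None, Some c') \<Rightarrow> w \<odot> c'
          | (Some b', Some c') \<Rightarrow> b' \<odot> w \<odot> c')"

definition orientable_equation :: "'a \<Rightarrow> 'a option \<Rightarrow> 'a option \<Rightarrow> bool" where
  "orientable_equation a b c \<longleftrightarrow>
     simple_equation a b c \<and>
     (\<exists>xs as bs cs.
        set xs \<subseteq> S \<and> set as \<subseteq> S \<and> set bs \<subseteq> S \<and> set cs \<subseteq> S \<and>
        Some a = list_product as \<and> b = list_product bs \<and> c = list_product cs \<and>
        length as + length bs + length cs = 2 * length xs \<and>
        length as = length bs + length cs \<and>
        mset as = mset xs \<and> mset (bs @ cs) = mset xs)"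

definition orientable :: "'a \<Rightarrow> bool" where
  "orientable w \<longleftrightarrow> w \<in> S \<and> (\<exists>a b c. orientable_equation a b c \<and> satisfies w a b c)"

definition Orientable :: "'a set" where
  "Orientable = {w. orientable w}"

end

lemma (in group) group_semigroup_on: "semigroup_on (carrier G) (\<otimes>\<^bsub>G\<^esub>)"
  by unfold_locales (auto simp: m_assoc)

end

theory Submission
  imports Defs "HOL-Algebra.Divisibility"
begin

text \<open>
  In the abelian quotient \<open>G / [G, G]\<close> the two sides of an orientable equation \<open>a = b t c\<close>
  force \<open>t\<close> to be trivial, so orientable elements lie in \<open>[G, G]\<close>. Conversely, the elements
  satisfying an orientable equation \<open>a = t c\<close> form a set that contains the commutators,
  as \<open>x y = t (y x)\<close> for \<open>t = x y x\<inverse> y\<inverse>\<close>, and is closed under products: if \<open>a = u c\<close> and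
  \<open>a' = v c'\<close> then \<open>a c\<inverse> a' = (u v) (c' c c\<inverse>)\<close>, where the factor \<open>c\<inverse>\<close> occurs once on each side.
\<close>

lemma (in monoid) multlist_append:
  assumes "set xs \<subseteq> carrier G" "set ys \<subseteq> carrier G"
  shows "foldr (\<otimes>) (xs @ ys) \<one> = foldr (\<otimes>) xs \<one> \<otimes> foldr (\<otimes>) ys \<one>"
  using assms by (induction xs) (auto simp: m_assoc)

text \<open>On a nonempty list, ending the product with an extra \<open>\<one>\<close> changes
  nothing, so only the empty list separates the semigroup product from the monoid fold.\<close>

lemma (in monoid) list_product_eq_multlist:
  assumes "semigroup_on (carrier G) (\<otimes>)" "set xs \<subseteq> carrier G"
  shows "semigroup_on.list_product (\<otimes>) xs =
    (if xs = [] then None else Some (foldr (\<otimes>) xs \<one>))"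
proof -
  interpret semigroup_on "carrier G" "(\<otimes>)" by fact
  show ?thesis
    using assms(2) by (induction xs) auto
qed

lemma (in group_hom) hom_multlist:
  assumes "set xs \<subseteq> carrier G"
  shows "h (foldr (\<otimes>\<^bsub>G\<^esub>) xs \<one>\<^bsub>G\<^esub>) = foldr (\<otimes>\<^bsub>H\<^esub>) (map h xs) \<one>\<^bsub>H\<^esub>"
  using assms by (induction xs) auto

text \<open>Since the fold of an empty list is \<open>\<one>\<close>, the single equation
  \<open>eq\<close> also covers absent coefficients.\<close>

lemma (in group) derived_if_multlist_eq:
  assumes w: "w \<in> carrier G"
    and bs: "set bs \<subseteq> carrier G" and cs: "set cs \<subseteq> carrier G"
    and perm: "mset as = mset (bs @ cs)"
    and eq: "foldr (\<otimes>) as \<one> = foldr (\<otimes>) bs \<one> \<otimes> w \<otimes> foldr (\<otimes>) cs \<one>"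
  shows "w \<in> derived G (carrier G)"
proof -
  define D where "D = derived G (carrier G)"
  interpret D: normal D G
    unfolding D_def by (rule derived_self_is_normal)
  interpret Q: comm_group "G Mod D"
    unfolding D_def by (rule derived_quot_is_comm_group)
  interpret h: group_hom G "G Mod D" "\<lambda>x. D #> x"
    by unfold_locales (rule D.r_coset_hom_Mod)
  let ?h = "\<lambda>x. D #> x"
  let ?P = "\<lambda>xs. foldr (\<otimes>) xs \<one>"
  have as: "set as \<subseteq> carrier G"
    using mset_eq_setD[OF perm] bs cs by auto
  have bscs: "set (bs @ cs) \<subseteq> carrier G"
    using bs cs by simp
  \<comment> \<open>In the commutative quotient a product depends only on the multiset of its
    factors.\<close>
  have "?h (?P as) = ?h (?P (bs @ cs))"
    unfolding h.hom_multlist[OF as] h.hom_multlist[OF bscs]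
  proof (rule Q.multlist_perm_cong)
    show "mset (map ?h as) = mset (map ?h (bs @ cs))"
      using perm by (metis mset_map)
  qed (use as h.hom_closed in auto)
  also have "\<dots> = ?h (?P bs) \<otimes>\<^bsub>G Mod D\<^esub> ?h (?P cs)"
    using bs cs by (simp add: multlist_append del: foldr_append)
  finally have "?h (?P bs) \<otimes>\<^bsub>G Mod D\<^esub> ?h (?P cs) =
      ?h (?P bs) \<otimes>\<^bsub>G Mod D\<^esub> ?h w \<otimes>\<^bsub>G Mod D\<^esub> ?h (?P cs)"
    using bs cs w by (simp only: eq h.hom_mult m_closed multlist_closed)
  then have "?h (?P bs) = ?h (?P bs) \<otimes>\<^bsub>G Mod D\<^esub> ?h w"
    using bs cs w by (simp only: Q.right_cancel Q.m_closed h.hom_closed multlist_closed)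
  then have "?h w = \<one>\<^bsub>G Mod D\<^esub>"
    using bs w by (metis Q.l_cancel_one' h.hom_closed multlist_closed)
  \<comment> \<open>The identity of the quotient is the coset \<open>D\<close> itself, and
    \<open>w\<close> lies in its own coset.\<close>
  then show ?thesis
    using w D.subgroup_axioms rcos_self unfolding D_def by fastforce
qed

text \<open>Equations with \<open>b\<close> absent suffice. Nonemptiness of \<open>as\<close>, and
  hence of \<open>cs\<close>, is carried along so that both folds can later be read as semigroup
  products.\<close>

lemma (in group) multlist_eq_if_derived:
  assumes "w \<in> derived G (carrier G)"
  shows "\<exists>as cs. as \<noteq> [] \<and> set as \<subseteq> carrier G \<and> mset as = mset cs \<and>
    foldr (\<otimes>) as \<one> = w \<otimes> foldr (\<otimes>) cs \<one>"
  using assms unfolding derived_def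
proof (induction rule: generate.induct)
  case one
  show ?case
    by (rule exI[of _ "[\<one>]"], rule exI[of _ "[\<one>]"]) simp
next
  case (incl w)
  then obtain x y where xy: "x \<in> carrier G" "y \<in> carrier G" "w = x \<otimes> y \<otimes> inv x \<otimes> inv y"
    by auto
  have eq: "x \<otimes> y = w \<otimes> (y \<otimes> x)"
    using xy by (simp add: m_assoc inv_solve_left inv_mult_group flip: m_assoc[of "inv y" y x])
  show ?case
    by (rule exI[of _ "[x, y]"], rule exI[of _ "[y, x]"]) (use xy(1,2) eq in \<open>simp add: add_mset_commute\<close>)
next
  case (inv w)
  then obtain x y where xy: "x \<in> carrier G" "y \<in> carrier G" "w = x \<otimes> y \<otimes> inv x \<otimes> inv y"
    by auto
  \<comment> \<open>The inverse of a commutator is the commutator of \<open>y\<close> and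
    \<open>x\<close>, so the two lists swap roles.\<close>
  have eq: "y \<otimes> x = inv w \<otimes> (x \<otimes> y)"
    using xy by (simp add: m_assoc inv_mult_group inv_solve_left flip: m_assoc[of "inv x" x y])
  show ?case
    by (rule exI[of _ "[y, x]"], rule exI[of _ "[x, y]"]) (use xy(1,2) eq in \<open>simp add: add_mset_commute\<close>)
next
  case (eng u v)
  have uv: "u \<in> carrier G" "v \<in> carrier G"
    using eng.hyps generate_in_carrier[OF derived_set_in_carrier[OF order_refl]] by auto
  let ?P = "\<lambda>xs. foldr (\<otimes>) xs \<one>"
  obtain as cs where 1: "as \<noteq> []" "set as \<subseteq> carrier G" "mset as = mset cs" "?P as = u \<otimes> ?P cs"
    using eng.IH(1) by blast
  obtain as' cs' where 2: "set as' \<subseteq> carrier G" "mset as' = mset cs'" "?P as' = v \<otimes> ?P cs'"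
    using eng.IH(2) by blast
  have cs: "set cs \<subseteq> carrier G" "set cs' \<subseteq> carrier G"
    using 1(2) 2(1) mset_eq_setD[OF 1(3)] mset_eq_setD[OF 2(2)] by auto
  define c where "c = ?P cs"
  define c' where "c' = ?P cs'"
  have c: "c \<in> carrier G" "c' \<in> carrier G"
    using cs by (auto simp: c_def c'_def)
  have "?P (as @ [inv c] @ as') = (u \<otimes> c) \<otimes> (inv c \<otimes> (v \<otimes> c'))"
    using 1 2 c by (simp add: multlist_append c_def c'_def del: foldr_append append_Cons)
  \<comment> \<open>Both sides equal \<open>u \<otimes> v \<otimes> c'\<close>: on the left
    \<open>inv c\<close> removes the \<open>c\<close> between \<open>u\<close> and \<open>v\<close>;
    on the right the cancelling pair balances the multisets.\<close>
  also have "\<dots> = (u \<otimes> v) \<otimes> (c' \<otimes> (c \<otimes> inv c))"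
    using uv c by (simp add: m_assoc flip: m_assoc[of c "inv c" "v \<otimes> c'"])
  also have "\<dots> = (u \<otimes> v) \<otimes> ?P (cs' @ cs @ [inv c])"
    using cs c by (simp add: multlist_append c_def c'_def del: foldr_append)
  finally have eq: "?P (as @ [inv c] @ as') = (u \<otimes> v) \<otimes> ?P (cs' @ cs @ [inv c])" .
  show ?case
    by (rule exI[of _ "as @ [inv c] @ as'"], rule exI[of _ "cs' @ cs @ [inv c]"])
      (use eq 1(1-3) 2(1,2) c(1) in \<open>simp add: ac_simps del: foldr_append\<close>)
qed

theorem theorem2p1:
  fixes G :: "('a, 'b) monoid_scheme"
  assumes "group G"
  shows "semigroup_on.Orientable (carrier G) (\<otimes>\<^bsub>G\<^esub>) = derived G (carrier G)"
proof -
  interpret group G by fact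
  interpret S: semigroup_on "carrier G" "(\<otimes>\<^bsub>G\<^esub>)"
    by (rule group_semigroup_on)
  note lp = list_product_eq_multlist[OF group_semigroup_on]
  show ?thesis
  proof (intro equalityI subsetI)
    fix w assume "w \<in> S.Orientable"
    then obtain a b c xs as bs cs where w: "w \<in> carrier G" and sat: "S.satisfies w a b c"
      and sets: "set as \<subseteq> carrier G" "set bs \<subseteq> carrier G" "set cs \<subseteq> carrier G"
      and prods: "Some a = S.list_product as" "b = S.list_product bs" "c = S.list_product cs"
      and perm: "mset as = mset xs" "mset (bs @ cs) = mset xs"
      unfolding S.Orientable_def S.orientable_def S.orientable_equation_def by blast
    \<comment> \<open>The proof splits on which of \<open>bs\<close> and \<open>cs\<close> are
      empty; an absent coefficient becomes a factor \<open>\<one>\<close>.\<close>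
    have "a = foldr (\<otimes>\<^bsub>G\<^esub>) bs \<one>\<^bsub>G\<^esub> \<otimes>\<^bsub>G\<^esub> w \<otimes>\<^bsub>G\<^esub> foldr (\<otimes>\<^bsub>G\<^esub>) cs \<one>\<^bsub>G\<^esub>"
      using sat w sets(2,3) unfolding S.satisfies_def prods(2,3)
      by (auto simp: lp split: if_splits)
    moreover have "a = foldr (\<otimes>\<^bsub>G\<^esub>) as \<one>\<^bsub>G\<^esub>"
      using prods(1) sets(1) by (simp add: lp split: if_splits)
    ultimately show "w \<in> derived G (carrier G)"
      using derived_if_multlist_eq[OF w sets(2,3), of as] perm by simp
  next
    fix w assume w: "w \<in> derived G (carrier G)"
    then obtain as cs where *: "as \<noteq> []" "set as \<subseteq> carrier G" "mset as = mset cs"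
      "foldr (\<otimes>\<^bsub>G\<^esub>) as \<one>\<^bsub>G\<^esub> = w \<otimes>\<^bsub>G\<^esub> foldr (\<otimes>\<^bsub>G\<^esub>) cs \<one>\<^bsub>G\<^esub>"
      using multlist_eq_if_derived by blast
    let ?a = "foldr (\<otimes>\<^bsub>G\<^esub>) as \<one>\<^bsub>G\<^esub>" and ?c = "foldr (\<otimes>\<^bsub>G\<^esub>) cs \<one>\<^bsub>G\<^esub>"
    have cs: "cs \<noteq> []" "set cs \<subseteq> carrier G" "length cs = length as"
      using * mset_eq_setD[OF *(3)] mset_eq_length[OF *(3)] by auto
    have simple: "S.simple_equation ?a None (Some ?c)"
      using *(2) cs(2) by (simp add: S.simple_equation_def)
    have "Some ?a = S.list_product as" "Some ?c = S.list_product cs"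
      using *(1,2) cs by (simp_all add: lp)
    \<comment> \<open>The list \<open>as\<close> itself serves as \<open>xs\<close>, and
      \<open>bs\<close> is empty.\<close>
    then have "S.orientable_equation ?a None (Some ?c)"
      unfolding S.orientable_equation_def
      by (intro conjI[OF simple], rule_tac x=as in exI, rule_tac x=as in exI,
          rule_tac x="[]" in exI, rule_tac x=cs in exI) (use *(2,3) cs(2,3) in simp)
    moreover have "S.satisfies w ?a None (Some ?c)"
      using *(4) by (simp add: S.satisfies_def)
    ultimately show "w \<in> S.Orientable"
      using w derived_in_carrier[OF order_refl]
      unfolding S.Orientable_def S.orientable_def by blast
  qed
qed

end
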